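(* Let $n>3$ and $\alpha\in(0,1]$, and let $\mathsf{s}_{\mathrm{opt}}=(s_1,\dots,s_n)$ with $s_i=\frac{2i-1}{2n}$ for $i\in\{1,\dots,n\}$. Assume the following hypothesis (a conjecture in the source): among all facilities $i$ and all unilateral deviations $s_i'\in[0,1]$ from $\mathsf{s}_{\mathrm{opt}}$, the highest improvement factor $u_i((\mathsf{s}_{\mathrm{opt}})_{-i},s_i')/u_i(\mathsf{s}_{\mathrm{opt}})$ is attained by one of the outmost facilities $1$ or $n$ changing her location towards the middle to her new interval border, i.e. to $s_1'=\beta_1'$ (respectively $s_n'=\beta_{n-1}'$), where $\beta_1'$ (respectively $\beta'_{n-1}$) is the inner border of that facility's client interval in the client equilibrium after the move. Then the game with $n$ facilities and parameter $\alpha$ has a $\rho$-SPE with $$\rho=\frac{n}{1+\frac{2}{1+\alpha}\tilde K^{n-2}}\Bigg(\frac{1-\alpha}{1+\alpha}\cdot\frac{3}{2n}+\sum_{k=2}^{n-1}\frac{1-\alpha}{1+\alpha}\cdot\frac{2k}{n}\prod_{j=n-k}^{n-2}\Big(-\frac{2}{\alpha}\tilde K^{j}\Big)+\frac{\alpha}{1+\alpha}\prod_{j=1}^{n-2}\Big(-\frac{2}{\alpha}\tilde K^{j}\Big)\Bigg),$$ where $\tilde K^{m}$ (with $m$ an index, not an exponent) is the continued fraction defined by $\tilde K^{1}=-\alpha^2/4$ and $\tilde K^{m}=\dfrac{-\alpha^2/4}{1+\tilde K^{m-1}}$ for $m\ge 2$.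
   Context: The game with parameters $n\ge 1$ and $\alpha\in[0,1]$: there are $n$ facility players $\{1,\dots,n\}$, each choosing a location $s_i\in[0,1]$; a facility location vector is $\mathsf{s}=(s_1,\dots,s_n)\in[0,1]^n$, and $(\mathsf{s}_{-i},s_i')$ is $\mathsf{s}$ with $s_i$ replaced by $s_i'$. The clients are the points $z\in[0,1]$. A client mapping is a function $\mathsf{f}:[0,1]^n\times[0,1]\to\{1,\dots,n\}$; client $z$ uses facility $\mathsf{f}(\mathsf{s},z)$. Only measurable mappings are considered: for every $\mathsf{s}$ and $i$, the set $\{z:\mathsf{f}(\mathsf{s},z)=i\}$ is a finite union of disjoint intervals; its total length is the load $\ell_i(\mathsf{s},\mathsf{f})$. The cost of client $z$ is $C_z(\mathsf{s},\mathsf{f})=(1-\alpha)|s_{\mathsf{f}(\mathsf{s},z)}-z|+\alpha\,\ell_{\mathsf{f}(\mathsf{s},z)}(\mathsf{s},\mathsf{f})$. The utility of facility $i$ is $u_i(\mathsf{s},\mathsf{f})=\ell_i(\mathsf{s},\mathsf{f})$. $\mathsf{f}(\mathsf{t},\cdot)$ is a client equilibrium if for all $z\in[0,1]$ and all $j$, $(1-\alpha)|t_{\mathsf{f}(\mathsf{t},z)}-z|+\alpha\ell_{\mathsf{f}(\mathsf{t},z)}(\mathsf{t},\mathsf{f})\le(1-\alpha)|t_j-z|+\alpha\ell_j(\mathsf{t},\mathsf{f})$. A pair $(\mathsf{s},\mathsf{f})$ is a $\rho$-SPE if (1) for all $i$ and all $s_i'\in[0,1]$, $\rho\cdot u_i(\mathsf{s},\mathsf{f})\ge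 u_i((\mathsf{s}_{-i},s_i'),\mathsf{f})$; and (2) $\mathsf{f}(\mathsf{t},\cdot)$ is a client equilibrium for every $\mathsf{t}\in[0,1]^n$. Induced client equilibrium: after renaming facilities so that $s_1\le\dots\le s_n$, a client equilibrium is proper if $[0,1]$ is partitioned (up to endpoints) into consecutive intervals $[\beta_{i-1},\beta_i]$, $\beta_0=0$, $\beta_n=1$, with facility $i$ serving $[\beta_{i-1},\beta_i]$. For $\alpha>0$ all client equilibria for a given $\mathsf{s}$ induce the same loads, and there is a unique proper one, in which the clients are assumed to be; its borders are the "interval borders", and $u_i(\mathsf{s})$ denotes the resulting utility. *)

theory Defs
  imports "HOL-Analysis.Analysis" "HOL-Combinatorics.Permutations"
begin

text \<open>
  Facilities are the numbers \<open>1, \<dots>, n\<close>, clients are the points of \<open>[0,1]\<close>.  A point of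
  \<open>[0,1]\<^sup>n\<close> is an extensional function, so that a client mapping, which takes the location
  vector as an argument, depends only on the coordinates \<open>1, \<dots>, n\<close>.
\<close>

definition location_vectors :: "nat \<Rightarrow> (nat \<Rightarrow> real) set" where
  "location_vectors n = {1..n} \<rightarrow>\<^sub>E {0..1}"

definition measurable_assignment :: "nat \<Rightarrow> (real \<Rightarrow> nat) \<Rightarrow> bool" where
  "measurable_assignment n g \<longleftrightarrow>
     (\<forall>z\<in>{0..1}. g z \<in> {1..n}) \<and>
     (\<forall>i\<in>{1..n}. \<exists>\<I>. finite \<I> \<and> disjoint \<I> \<and> (\<forall>I\<in>\<I>. is_interval I) \<and>
        {z \<in> {0..1}. g z = i} = \<Union>\<I>)"

definition load :: "(real \<Rightarrow> nat) \<Rightarrow> nat \<Rightarrow> real" where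
  "load g i = measure lborel {z \<in> {0..1}. g z = i}"

definition facility_cost :: "real \<Rightarrow> (nat \<Rightarrow> real) \<Rightarrow> (real \<Rightarrow> nat) \<Rightarrow> nat \<Rightarrow> real \<Rightarrow> real" where
  "facility_cost \<alpha> s g i z = (1 - \<alpha>) * \<bar>s i - z\<bar> + \<alpha> * load g i"

definition client_equilibrium :: "nat \<Rightarrow> real \<Rightarrow> (nat \<Rightarrow> real) \<Rightarrow> (real \<Rightarrow> nat) \<Rightarrow> bool" where
  "client_equilibrium n \<alpha> s g \<longleftrightarrow>
     measurable_assignment n g \<and>
     (\<forall>z\<in>{0..1}. \<forall>j\<in>{1..n}. facility_cost \<alpha> s g (g z) z \<le> facility_cost \<alpha> s g j z)"

definition is_rho_SPE ::
  "nat \<Rightarrow> real \<Rightarrow> real \<Rightarrow> (nat \<Rightarrow> real) \<Rightarrow> ((nat \<Rightarrow> real) \<Rightarrow> real \<Rightarrow> nat) \<Rightarrow> bool" where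
  "is_rho_SPE n \<alpha> \<rho> s f \<longleftrightarrow>
     s \<in> location_vectors n \<and>
     (\<forall>i\<in>{1..n}. \<forall>x\<in>{0..1}. \<rho> * load (f s) i \<ge> load (f (s(i := x))) i) \<and>
     (\<forall>t\<in>location_vectors n. client_equilibrium n \<alpha> t (f t))"

text \<open>
  The permutation \<open>\<pi>\<close> is the renaming: \<open>\<pi> i\<close> is the \<open>i\<close>-th facility from the left, and it
  serves the clients between the borders \<open>\<beta> (i - 1)\<close> and \<open>\<beta> i\<close>.  Which of its neighbours
  serves a border point itself is left open.
\<close>

definition proper_client_equilibrium ::
  "nat \<Rightarrow> real \<Rightarrow> (nat \<Rightarrow> real) \<Rightarrow> (nat \<Rightarrow> nat) \<Rightarrow> (nat \<Rightarrow> real) \<Rightarrow> (real \<Rightarrow> nat) \<Rightarrow> bool" where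
  "proper_client_equilibrium n \<alpha> s \<pi> \<beta> g \<longleftrightarrow>
     client_equilibrium n \<alpha> s g \<and>
     \<pi> permutes {1..n} \<and> mono_on {1..n} (s \<circ> \<pi>) \<and>
     \<beta> 0 = 0 \<and> \<beta> n = 1 \<and> mono_on {0..n} \<beta> \<and>
     (\<forall>i\<in>{1..n}. \<forall>z\<in>{\<beta> (i - 1)<..<\<beta> i}. g z = \<pi> i)"

definition induced_utility :: "nat \<Rightarrow> real \<Rightarrow> (nat \<Rightarrow> real) \<Rightarrow> nat \<Rightarrow> real" where
  "induced_utility n \<alpha> s i =
     (THE u. \<exists>\<pi> \<beta> g. proper_client_equilibrium n \<alpha> s \<pi> \<beta> g \<and> u = load g i)"

definition improvement_factor :: "nat \<Rightarrow> real \<Rightarrow> (nat \<Rightarrow> real) \<Rightarrow> nat \<Rightarrow> real \<Rightarrow> real" where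
  "improvement_factor n \<alpha> s i x = induced_utility n \<alpha> (s(i := x)) i / induced_utility n \<alpha> s i"

definition highest_improvement :: "nat \<Rightarrow> real \<Rightarrow> (nat \<Rightarrow> real) \<Rightarrow> nat \<Rightarrow> real \<Rightarrow> bool" where
  "highest_improvement n \<alpha> s i x \<longleftrightarrow>
     i \<in> {1..n} \<and> x \<in> {0..1} \<and>
     (\<forall>j\<in>{1..n}. \<forall>y\<in>{0..1}. improvement_factor n \<alpha> s j y \<le> improvement_factor n \<alpha> s i x)"

definition s_opt :: "nat \<Rightarrow> nat \<Rightarrow> real" where
  "s_opt n = (\<lambda>i\<in>{1..n}. (2 * real i - 1) / (2 * real n))"

text \<open>The continued fraction starts at index 1; the value at 0 is a dummy.\<close>

fun K_tilde :: "real \<Rightarrow> nat \<Rightarrow> real" where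
  "K_tilde \<alpha> 0 = 0"
| "K_tilde \<alpha> (Suc 0) = - (\<alpha>\<^sup>2 / 4)"
| "K_tilde \<alpha> (Suc (Suc m)) = - (\<alpha>\<^sup>2 / 4) / (1 + K_tilde \<alpha> (Suc m))"

end

theory Submission
  imports Defs
begin

text \<open>
  The loads of all client equilibria for a given location vector agree.  For facilities sorted
  by a permutation, with positions \<open>p 1 \<le> \<dots> \<le> p n\<close>, a proper equilibrium is the same as
  borders \<open>\<beta>\<close> at which the two adjacent facilities cost the same, i.e. the second differences
  of \<open>\<beta>\<close> satisfy \<open>\<alpha> (\<beta> (i + 1) - 2 \<beta> i + \<beta> (i - 1)) = (1 - \<alpha>) (\<bar>p i - \<beta> i\<bar> - \<bar>p (i + 1) - \<beta> i\<bar>)\<close>;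
  a shooting argument in the first load solves this recurrence with \<open>\<beta> 0 = 0\<close>, \<open>\<beta> n = 1\<close>.

  When an outmost facility sits at her own border, comparing \<open>\<beta> i\<close> with \<open>i / n\<close> by a discrete
  maximum principle places every border between its two facilities, so the absolute values
  disappear and the borders solve a tridiagonal linear system.  Backward elimination produces
  the continued fraction.  The load at the optimum being \<open>1 / n\<close>, the improvement factor of this
  deviation is \<open>n\<close> times the border.
\<close>

section \<open>Solving the balance equations by shooting\<close>

text \<open>The balance equation of a border, divided by \<alpha> and solved for the next border:
  \<open>c\<close> stands for \<open>(1 - \<alpha>) / \<alpha>\<close>, and \<open>y\<close> is the
  trial value of the first load.\<close>

fun shoot :: "real \<Rightarrow> (nat \<Rightarrow> real) \<Rightarrow> real \<Rightarrow> nat \<Rightarrow> real" where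
  "shoot c p y 0 = 0"
| "shoot c p y (Suc 0) = y"
| "shoot c p y (Suc (Suc i)) = 2 * shoot c p y (Suc i) - shoot c p y i +
     c * (\<bar>p (Suc i) - shoot c p y (Suc i)\<bar> - \<bar>p (Suc (Suc i)) - shoot c p y (Suc i)\<bar>)"

lemma sorting_permutation_exists:
  fixes t :: "nat \<Rightarrow> 'a::linorder"
  shows "\<exists>\<pi>. \<pi> permutes {1..n} \<and> mono_on {1..n} (t \<circ> \<pi>)"
proof -
  define xs where "xs = sort_key t [1..<Suc n]"
  have len: "length xs = n" and set: "set xs = {1..n}" and dist: "distinct xs"
    and sorted: "sorted (map t xs)"
    by (auto simp: xs_def)
  define \<pi> where "\<pi> = (\<lambda>i. if i \<in> {1..n} then xs ! (i - 1) else i)"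
  have "bij_betw (\<lambda>i. i - 1) {1..n} {..<n}"
    by (rule bij_betw_byWitness[where f' = Suc]) auto
  from bij_betw_trans[OF this bij_betw_nth[OF dist _ set[symmetric]]]
  have "bij_betw ((!) xs \<circ> (\<lambda>i. i - 1)) {1..n} {1..n}" by (simp add: len)
  then have "bij_betw \<pi> {1..n} {1..n}"
    by (rule iffD1[OF bij_betw_cong, rotated]) (auto simp: \<pi>_def)
  then have "\<pi> permutes {1..n}"
    by (rule bij_imp_permutes) (auto simp: \<pi>_def)
  moreover have "mono_on {1..n} (t \<circ> \<pi>)"
  proof (rule mono_onI)
    fix i j assume "i \<in> {1..n}" "j \<in> {1..n}" "i \<le> j"
    with sorted_nth_mono[OF sorted, of "i - 1" "j - 1"] len
    show "(t \<circ> \<pi>) i \<le> (t \<circ> \<pi>) j" by (auto simp: \<pi>_def)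
  qed
  ultimately show ?thesis by blast
qed

definition balanced_borders :: "nat \<Rightarrow> real \<Rightarrow> (nat \<Rightarrow> real) \<Rightarrow> (nat \<Rightarrow> real) \<Rightarrow> bool" where
  "balanced_borders n \<alpha> p \<beta> \<longleftrightarrow>
     \<beta> 0 = 0 \<and> \<beta> n = 1 \<and> mono_on {0..n} \<beta> \<and>
     (\<forall>i\<in>{1..<n}. \<alpha> * (\<beta> (i + 1) - 2 * \<beta> i + \<beta> (i - 1)) =
        (1 - \<alpha>) * (\<bar>p i - \<beta> i\<bar> - \<bar>p (i + 1) - \<beta> i\<bar>))"

text \<open>
  A negative step at \<open>m\<close> puts the border left of facility \<open>m + 1\<close>; from there on all steps
  are negative, so the last border stays below \<open>1\<close>.
\<close>

lemma shoot_mono_borders: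
  assumes c: "c \<ge> 0" and p: "mono_on {1..n} p" and p01: "\<And>i. i \<in> {1..n} \<Longrightarrow> p i \<in> {0..1}"
    and y: "y \<ge> 0" and end1: "shoot c p y n = 1" and i: "i < n"
  shows "shoot c p y i \<le> shoot c p y (Suc i)"
proof (rule ccontr)
  assume "\<not> ?thesis"
  with i have "\<exists>i. i < n \<and> shoot c p y (Suc i) < shoot c p y i" by auto
  then obtain m where m: "m < n" "shoot c p y (Suc m) < shoot c p y m"
    and least: "\<And>k. k < m \<Longrightarrow> shoot c p y k \<le> shoot c p y (Suc k)"
    by (subst (asm) exists_least_iff) (metis linorder_not_le order.strict_trans)
  from m y obtain l where l: "m = Suc l" by (cases m) auto
  define b where "b = shoot c p y"
  \<comment> \<open>The step before \<open>m\<close> did not descend and the step at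
    \<open>m\<close> does, so the distance term in the recurrence is negative.\<close>
  have "c * (\<bar>p m - b m\<bar> - \<bar>p (Suc m) - b m\<bar>) < 0"
    using m least[of l] by (simp add: l b_def)
  then have neg: "\<bar>p m - b m\<bar> < \<bar>p (Suc m) - b m\<bar>"
    using c by (simp add: mult_less_0_iff)
  have "p m \<le> p (Suc m)" using p m l by (auto intro: mono_onD)
  with neg have bm: "b m < p (Suc m)" by arith
  have "b k < p (Suc m) \<and> b (Suc k) < b k" if "m \<le> k" "Suc k \<le> n" for k
    using that
  proof (induction k rule: dec_induct)
    case base
    show ?case using bm m by (simp add: b_def)
  next
    case (step k)
    then have IH: "b k < p (Suc m)" "b (Suc k) < b k" by auto
    have *: "p (Suc m) \<le> p (Suc k)" "p (Suc k) \<le> p (Suc (Suc k))"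
      using step by (auto intro!: mono_onD[OF p])
    \<comment> \<open>The border lies left of both facilities, so the distance difference is minus
      the gap between them and cannot stop the descent.\<close>
    have "b (Suc (Suc k)) - b (Suc k) = b (Suc k) - b k + c * (p (Suc k) - p (Suc (Suc k)))"
      using IH * by (simp add: b_def)
    moreover have "c * (p (Suc k) - p (Suc (Suc k))) \<le> 0"
      using c * by (simp add: mult_nonneg_nonpos)
    ultimately show ?case using IH by auto
  qed
  moreover have "m \<le> n - 1" "Suc (n - 1) = n" using m by auto
  ultimately have "b n < p (Suc m)" by (metis order.refl order.strict_trans)
  with end1 p01[of "Suc m"] m show False by (auto simp: b_def)
qed

text \<open>The end value is continuous in the first load \<open>y\<close>. For \<open>y = 0\<close>
  the borders never pass 0 and so stay left of every facility; for \<open>y = 1\<close> they stay at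
  or beyond 1 from the first one on. The intermediate value theorem then yields the end value
  1.\<close>

lemma balanced_borders_exist:
  assumes n: "n \<ge> 1" and \<alpha>: "\<alpha> \<in> {0<..1}" and p: "mono_on {1..n} p"
    and p01: "\<And>i. i \<in> {1..n} \<Longrightarrow> p i \<in> {0..1}"
  shows "\<exists>\<beta>. balanced_borders n \<alpha> p \<beta>"
proof -
  define c where "c = (1 - \<alpha>) / \<alpha>"
  have c: "c \<ge> 0" using \<alpha> by (auto simp: c_def)
  have cont: "continuous_on {0..1} (\<lambda>y. shoot c p y i)" for i
    by (induction c p "0::real" i rule: shoot.induct) (auto intro!: continuous_intros)
  have low: "shoot c p 0 (Suc i) \<le> shoot c p 0 i \<and> shoot c p 0 (Suc i) \<le> 0" if "Suc i \<le> n" for i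
    using that
  proof (induction i)
    case (Suc i)
    have *: "p (Suc i) \<le> p (Suc (Suc i))" "0 \<le> p (Suc i)"
      using Suc.prems p01[of "Suc i"] by (auto intro!: mono_onD[OF p])
    then have "c * (p (Suc i) - p (Suc (Suc i))) \<le> 0"
      using c by (simp add: mult_nonneg_nonpos)
    with Suc * show ?case by simp
  qed simp
  have up: "shoot c p 1 i \<le> shoot c p 1 (Suc i) \<and> 1 \<le> shoot c p 1 (Suc i)" if "Suc i \<le> n" for i
    using that
  proof (induction i)
    case (Suc i)
    have *: "p (Suc i) \<le> p (Suc (Suc i))" "p (Suc (Suc i)) \<le> 1"
      using Suc.prems p01[of "Suc (Suc i)"] by (auto intro!: mono_onD[OF p])
    then have "c * (p (Suc (Suc i)) - p (Suc i)) \<ge> 0"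
      using c by simp
    with Suc * show ?case by simp
  qed simp
  have "\<exists>y\<ge>0. y \<le> 1 \<and> shoot c p y n = 1"
    using low[of "n - 1"] up[of "n - 1"] n by (intro IVT' cont) auto
  then obtain y where y: "y \<ge> 0" "shoot c p y n = 1" by blast
  define \<beta> where "\<beta> = shoot c p y"
  have "mono_on {0..n} \<beta>"
  proof (rule mono_onI)
    fix i j assume "i \<in> {0..n}" "j \<in> {0..n}" "i \<le> j"
    from \<open>i \<le> j\<close> \<open>j \<in> {0..n}\<close> show "\<beta> i \<le> \<beta> j"
    proof (induction j rule: dec_induct)
      case (step j)
      with shoot_mono_borders[OF c p p01 y, of j] show ?case by (simp add: \<beta>_def)
    qed simp
  qed
  moreover have "\<alpha> * (\<beta> (i + 1) - 2 * \<beta> i + \<beta> (i - 1)) =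
      (1 - \<alpha>) * (\<bar>p i - \<beta> i\<bar> - \<bar>p (i + 1) - \<beta> i\<bar>)" if "i \<in> {1..<n}" for i
  proof -
    from that obtain j where "i = Suc j" by (cases i) auto
    with \<alpha> show ?thesis by (simp add: \<beta>_def c_def)
  qed
  ultimately show ?thesis using y(2) by (auto simp: balanced_borders_def \<beta>_def intro!: exI[of _ \<beta>])
qed

section \<open>Measures of client sets and uniqueness of loads\<close>

lemma measurable_assignment_sets:
  assumes "measurable_assignment n g" "i \<in> {1..n}"
  shows "{z \<in> {0..1}. g z = i} \<in> sets lborel"
proof -
  from assms obtain \<I> where \<I>: "finite \<I>" "\<forall>I\<in>\<I>. is_interval I" "{z \<in> {0..1}. g z = i} = \<Union>\<I>"
    unfolding measurable_assignment_def by blast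
  have "\<Union>\<I> \<in> sets borel"
    using \<I>(1,2) by (intro sets.finite_Union) (auto intro: real_interval_borel_measurable)
  with \<I>(3) show ?thesis by simp
qed

text \<open>\<open>measure\<close> assigns 0 to sets of infinite measure, so monotonicity requires a
  finite larger set; the unit interval supplies the bound.\<close>

lemma measure_mono_unit_interval:
  fixes A B :: "real set"
  assumes "A \<subseteq> B" "B \<subseteq> {0..1}" "A \<in> sets lborel" "B \<in> sets lborel"
  shows "measure lborel A \<le> measure lborel B"
proof -
  have "emeasure lborel B \<le> emeasure lborel {0..1::real}"
    using assms(2) by (intro emeasure_mono) auto
  then have "B \<in> fmeasurable lborel"
    using assms(4) by (intro fmeasurableI) (auto simp: le_less_trans)
  with assms show ?thesis by (intro measure_mono_fmeasurable) auto
qed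

text \<open>Turns a comparison of the total loads of a group \<open>J\<close> into a comparison of
  client sets.\<close>

lemma sum_load:
  assumes g: "measurable_assignment n g" and J: "J \<subseteq> {1..n}"
  shows "{z \<in> {0..1}. g z \<in> J} \<in> sets lborel"
    and "(\<Sum>i\<in>J. load g i) = measure lborel {z \<in> {0..1}. g z \<in> J}"
proof -
  have fin: "finite J" using J finite_subset by auto
  have un: "{z \<in> {0..1}. g z \<in> J} = (\<Union>i\<in>J. {z \<in> {0..1}. g z = i})" by auto
  have sets: "{z \<in> {0..1}. g z = i} \<in> sets lborel" if "i \<in> J" for i
    using measurable_assignment_sets[OF g] J that by auto
  show "{z \<in> {0..1}. g z \<in> J} \<in> sets lborel"
    unfolding un using fin sets by blast
  have "emeasure lborel {z \<in> {0..1}. g z = i} \<noteq> \<infinity>" for i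
  proof -
    have "emeasure lborel {z \<in> {0..1}. g z = i} \<le> emeasure lborel {0..1::real}"
      by (intro emeasure_mono) auto
    then show ?thesis by (auto simp: top_unique)
  qed
  then show "(\<Sum>i\<in>J. load g i) = measure lborel {z \<in> {0..1}. g z \<in> J}"
    unfolding un load_def using fin sets
    by (intro measure_finite_Union[symmetric]) (auto simp: disjoint_family_on_def)
qed

text \<open>
  If some loads increased, every client who uses, in the second equilibrium, a facility with the
  largest increase would already use such a facility in the first one.
\<close>

lemma client_equilibrium_load_le:
  assumes \<alpha>: "\<alpha> > 0" and g: "client_equilibrium n \<alpha> t g" and h: "client_equilibrium n \<alpha> t h"
    and i: "i \<in> {1..n}"
  shows "load h i \<le> load g i"
proof (rule ccontr)
  assume i_gt: "\<not> ?thesis"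
  define d where "d j = load h j - load g j" for j
  define \<delta> where "\<delta> = Max (d ` {1..n})"
  define J where "J = {j \<in> {1..n}. d j = \<delta>}"
  have le: "d j \<le> \<delta>" if "j \<in> {1..n}" for j
    using that by (auto simp: \<delta>_def)
  have "\<delta> \<in> d ` {1..n}"
    unfolding \<delta>_def using i by (intro Max_in) auto
  then have "J \<noteq> {}" by (auto simp: J_def)
  have "\<delta> > 0" using le[OF i] i_gt by (simp add: d_def)
  have gm: "measurable_assignment n g" and hm: "measurable_assignment n h"
    using g h by (auto simp: client_equilibrium_def)
  have sub: "{z \<in> {0..1}. h z \<in> J} \<subseteq> {z \<in> {0..1}. g z \<in> J}"
  proof safe
    fix z :: real assume z: "z \<in> {0..1}" and hz: "h z \<in> J"
    have gz: "g z \<in> {1..n}" using gm z by (auto simp: measurable_assignment_def)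
    have hn: "h z \<in> {1..n}" "load h (h z) = load g (h z) + \<delta>"
      using hz by (auto simp: J_def d_def)
    \<comment> \<open>Adding the two inequalities cancels the distances of \<open>z\<close> and
      leaves only loads.\<close>
    have "facility_cost \<alpha> t g (g z) z \<le> facility_cost \<alpha> t g (h z) z"
      and "facility_cost \<alpha> t h (h z) z \<le> facility_cost \<alpha> t h (g z) z"
      using g h z gz hn by (auto simp: client_equilibrium_def)
    then have "\<alpha> * load g (g z) + \<alpha> * load h (h z) \<le> \<alpha> * load h (g z) + \<alpha> * load g (h z)"
      by (simp add: facility_cost_def)
    then have "\<alpha> * \<delta> \<le> \<alpha> * d (g z)"
      unfolding hn(2) d_def by (simp add: algebra_simps)
    with \<alpha> have "\<delta> \<le> d (g z)" by simp
    with le[OF gz] gz show "g z \<in> J" by (auto simp: J_def)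
  qed
  have Jn: "J \<subseteq> {1..n}" by (auto simp: J_def)
  \<comment> \<open>The inclusion bounds the total load of \<open>J\<close>, although every load in
    \<open>J\<close> grew by \<delta> > 0.\<close>
  have "(\<Sum>j\<in>J. load h j) \<le> (\<Sum>j\<in>J. load g j)"
    unfolding sum_load(2)[OF gm Jn] sum_load(2)[OF hm Jn]
    using sum_load(1)[OF gm Jn] sum_load(1)[OF hm Jn] sub
    by (intro measure_mono_unit_interval) auto
  moreover have "(\<Sum>j\<in>J. load g j) < (\<Sum>j\<in>J. load h j)"
    using \<open>J \<noteq> {}\<close> \<open>\<delta> > 0\<close>
    by (intro sum_strict_mono) (auto simp: J_def d_def)
  ultimately show False by simp
qed

lemma client_equilibrium_load_unique:
  assumes "\<alpha> > 0" "client_equilibrium n \<alpha> t g" "client_equilibrium n \<alpha> t h" "i \<in> {1..n}"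
  shows "load g i = load h i"
  using client_equilibrium_load_le assms by (metis order.antisym)

text \<open>Each client set is an open interval up to border points. These are finitely many, hence
  a null set, so it does not matter who serves them.\<close>

lemma load_between_borders:
  assumes perm: "\<pi> permutes {1..n}" and \<beta>: "\<beta> 0 = 0" "\<beta> n = 1" "mono_on {0..n} \<beta>"
    and g: "\<forall>i\<in>{1..n}. \<forall>z\<in>{\<beta> (i - 1)<..<\<beta> i}. g z = \<pi> i"
    and i: "i \<in> {1..n}"
  shows "load g (\<pi> i) = \<beta> i - \<beta> (i - 1)"
proof -
  define F where "F = \<beta> ` {0..n}"
  have "finite F" by (simp add: F_def)
  have sub1: "{\<beta> (i - 1)<..<\<beta> i} \<subseteq> {z \<in> {0..1}. g z = \<pi> i}"
  proof
    fix z assume z: "z \<in> {\<beta> (i - 1)<..<\<beta> i}"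
    have "\<beta> 0 \<le> \<beta> (i - 1)" "\<beta> i \<le> \<beta> n"
      using i by (auto intro!: mono_onD[OF \<beta>(3)])
    with z i g \<beta>(1,2) show "z \<in> {z \<in> {0..1}. g z = \<pi> i}" by auto
  qed
  have sub2: "z \<in> {\<beta> (i - 1)<..<\<beta> i}" if z: "z \<in> {0..1}" "g z = \<pi> i" "z \<notin> F" for z
  proof -
    have "z < \<beta> n" using z \<beta> by (metis F_def atLeastAtMost_iff image_eqI le0 order_refl order_le_less)
    \<comment> \<open>As \<open>z\<close> is no border itself, the first border to its right singles
      out the open interval containing it.\<close>
    define j where "j = (LEAST j. z < \<beta> j)"
    have j: "z < \<beta> j" "j \<le> n"
      using \<open>z < \<beta> n\<close> by (auto simp: j_def intro: LeastI Least_le)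
    have "j \<noteq> 0" using j z \<beta>(1) by (intro notI) auto
    then have "\<not> z < \<beta> (j - 1)" using not_less_Least[of "j - 1" "\<lambda>j. z < \<beta> j"] by (simp add: j_def)
    moreover have "\<beta> (j - 1) \<noteq> z" using z j by (auto simp: F_def)
    ultimately have zj: "z \<in> {\<beta> (j - 1)<..<\<beta> j}" using j by auto
    with g j \<open>j \<noteq> 0\<close> have "g z = \<pi> j" by auto
    with z have "j = i" using perm by (metis permutes_inj injD)
    with zj show ?thesis by simp
  qed
  have un: "{z \<in> {0..1}. g z = \<pi> i} = {\<beta> (i - 1)<..<\<beta> i} \<union> ({z \<in> {0..1}. g z = \<pi> i} \<inter> F)"
    using sub1 sub2 by blast
  have null: "{z \<in> {0..1}. g z = \<pi> i} \<inter> F \<in> null_sets lborel"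
    using \<open>finite F\<close> by (intro finite_imp_null_set_lborel) auto
  have "load g (\<pi> i) = measure lborel {\<beta> (i - 1)<..<\<beta> i}"
    unfolding load_def by (subst un, rule measure_Un_null_set[OF _ null]) simp
  moreover have "\<beta> (i - 1) \<le> \<beta> i"
    using i by (auto intro!: mono_onD[OF \<beta>(3)])
  ultimately show ?thesis by simp
qed

lemma proper_client_equilibrium_load:
  assumes "proper_client_equilibrium n \<alpha> t \<pi> \<beta> g" "i \<in> {1..n}"
  shows "load g (\<pi> i) = \<beta> i - \<beta> (i - 1)"
  using assms unfolding proper_client_equilibrium_def by (intro load_between_borders) auto

section \<open>From balanced borders to client equilibria\<close>

text \<open>As a client moves right, the right-hand facility gains relative to the left-hand one. A
  tie at a border therefore settles the preference on either side of it.\<close>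

lemma abs_diff_mono:
  fixes a b z w :: real
  assumes "a \<le> b" "z \<le> w"
  shows "\<bar>a - z\<bar> - \<bar>b - z\<bar> \<le> \<bar>a - w\<bar> - \<bar>b - w\<bar>"
  using assms by arith

text \<open>Neighbouring facilities cost the same at their common border, so on each side the
  facility of that side is at least as cheap. Chaining these comparisons outwards from the facility
  serving \<open>z\<close> gives optimality.\<close>

lemma balanced_borders_imp_proper:
  assumes \<alpha>: "\<alpha> \<in> {0<..1}" and n: "n \<ge> 1" and perm: "\<pi> permutes {1..n}"
    and mono: "mono_on {1..n} (t \<circ> \<pi>)" and bal: "balanced_borders n \<alpha> (t \<circ> \<pi>) \<beta>"
  shows "\<exists>g. proper_client_equilibrium n \<alpha> t \<pi> \<beta> g"
proof -
  have \<beta>: "\<beta> 0 = 0" "\<beta> n = 1" "mono_on {0..n} \<beta>"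
    and eq: "\<And>i. i \<in> {1..<n} \<Longrightarrow> \<alpha> * (\<beta> (i + 1) - 2 * \<beta> i + \<beta> (i - 1)) =
        (1 - \<alpha>) * (\<bar>t (\<pi> i) - \<beta> i\<bar> - \<bar>t (\<pi> (i + 1)) - \<beta> i\<bar>)"
    using bal by (auto simp: balanced_borders_def)
  \<comment> \<open>A border point goes to the lowest index it admits. The condition
    \<open>1 \<le> i\<close> excludes index 0, which \<open>z = 0\<close> would otherwise
    select.\<close>
  define m where "m z = (LEAST i. 1 \<le> i \<and> z \<le> \<beta> i)" for z
  define g where "g z = \<pi> (m z)" for z
  have m: "m z \<in> {1..n} \<and> z \<le> \<beta> (m z)" if "z \<le> 1" for z
  proof -
    have P: "1 \<le> n \<and> z \<le> \<beta> n" using that \<beta> n by auto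
    from LeastI[of "\<lambda>i. 1 \<le> i \<and> z \<le> \<beta> i", OF P] Least_le[of "\<lambda>i. 1 \<le> i \<and> z \<le> \<beta> i", OF P]
    show ?thesis by (auto simp: m_def)
  qed
  have m_lower: "\<beta> (m z - 1) \<le> z" if "z \<in> {0..1}" for z
  proof (cases "m z \<le> 1")
    case True
    with that \<beta>(1) show ?thesis by simp
  next
    case False
    with not_less_Least[of "m z - 1" "\<lambda>i. 1 \<le> i \<and> z \<le> \<beta> i"] show ?thesis by (auto simp: m_def)
  qed
  have m_eq: "m z = i" if i: "i \<in> {1..n}" and z: "z \<in> {\<beta> (i - 1)<..<\<beta> i}" for i z
    unfolding m_def
  proof (rule Least_equality)
    show "1 \<le> i \<and> z \<le> \<beta> i" using i z by auto
    fix k assume k: "1 \<le> k \<and> z \<le> \<beta> k"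
    show "i \<le> k"
    proof (rule ccontr)
      assume "\<not> i \<le> k"
      with i have "\<beta> k \<le> \<beta> (i - 1)" by (intro mono_onD[OF \<beta>(3)]) auto
      with k z show False by auto
    qed
  qed
  have m_mono: "m z \<le> m w" if "z \<le> w" "w \<le> 1" for z w
    unfolding m_def[of z] using m[OF that(2)] that by (intro Least_le) auto
  have gb: "\<forall>i\<in>{1..n}. \<forall>z\<in>{\<beta> (i - 1)<..<\<beta> i}. g z = \<pi> i"
    using m_eq by (auto simp: g_def)
  have load: "load g (\<pi> i) = \<beta> i - \<beta> (i - 1)" if "i \<in> {1..n}" for i
    by (rule load_between_borders[OF perm \<beta> gb that])
  have inj: "\<pi> a = \<pi> b \<longleftrightarrow> a = b" for a b
    using permutes_inj[OF perm] by (auto dest: injD)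
  have "measurable_assignment n g"
    unfolding measurable_assignment_def
  proof (intro conjI ballI)
    fix z :: real assume "z \<in> {0..1}"
    with m[of z] show "g z \<in> {1..n}" using permutes_in_image[OF perm] by (simp add: g_def)
  next
    fix i assume "i \<in> {1..n}"
    define A where "A = {z \<in> {0..1}. g z = i}"
    have "is_interval A"
      unfolding is_interval_1
    proof safe
      fix a b x assume a: "a \<in> A" and b: "b \<in> A" and x: "a \<le> x" "x \<le> b"
      then have "m a = m b" "m a \<le> m x" "m x \<le> m b" "0 \<le> x" "x \<le> 1"
        using inj by (auto simp: A_def g_def intro!: m_mono)
      then have "m x = m a" by simp
      with a \<open>0 \<le> x\<close> \<open>x \<le> 1\<close> show "x \<in> A" by (simp add: A_def g_def)
    qed
    then show "\<exists>\<I>. finite \<I> \<and> disjoint \<I> \<and> (\<forall>I\<in>\<I>. is_interval I) \<and> {z \<in> {0..1}. g z = i} = \<Union>\<I>"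
      by (intro exI[of _ "{A}"]) (auto simp: A_def)
  qed
  moreover have "facility_cost \<alpha> t g (g z) z \<le> facility_cost \<alpha> t g j z"
    if z: "z \<in> {0..1}" and j: "j \<in> {1..n}" for z j
  proof -
    define C where "C i = facility_cost \<alpha> t g (\<pi> i) z" for i
    \<comment> \<open>The balance equation expresses the load difference by distances at the border,
      so the cost difference compares two distance differences, at \<open>z\<close> and at
      \<open>\<beta> i\<close>.\<close>
    have diff: "C i - C (Suc i) = (1 - \<alpha>) * ((\<bar>t (\<pi> i) - z\<bar> - \<bar>t (\<pi> (Suc i)) - z\<bar>) -
        (\<bar>t (\<pi> i) - \<beta> i\<bar> - \<bar>t (\<pi> (Suc i)) - \<beta> i\<bar>))" if "i \<in> {1..<n}" for i
    proof -
      have "\<alpha> * load g (\<pi> (Suc i)) - \<alpha> * load g (\<pi> i) =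
          \<alpha> * (\<beta> (i + 1) - 2 * \<beta> i + \<beta> (i - 1))"
        unfolding right_diff_distrib[symmetric] using load[of i] load[of "Suc i"] that by simp
      also have "\<dots> = (1 - \<alpha>) * (\<bar>t (\<pi> i) - \<beta> i\<bar> - \<bar>t (\<pi> (Suc i)) - \<beta> i\<bar>)"
        using eq[OF that] by simp
      finally have "\<alpha> * load g (\<pi> (Suc i)) - \<alpha> * load g (\<pi> i) =
          (1 - \<alpha>) * (\<bar>t (\<pi> i) - \<beta> i\<bar> - \<bar>t (\<pi> (Suc i)) - \<beta> i\<bar>)" .
      then show ?thesis
        by (simp add: C_def facility_cost_def right_diff_distrib)
    qed
    have tle: "t (\<pi> i) \<le> t (\<pi> (Suc i))" if "i \<in> {1..<n}" for i
      using mono_onD[OF mono, of i "Suc i"] that by auto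
    have up: "C i \<le> C (Suc i)" if "i \<in> {1..<n}" "z \<le> \<beta> i" for i
    proof -
      have "C i - C (Suc i) \<le> 0"
        unfolding diff[OF that(1)] using abs_diff_mono[OF tle[OF that(1)] that(2)] \<alpha>
        by (intro mult_nonneg_nonpos) auto
      then show ?thesis by simp
    qed
    have down: "C (Suc i) \<le> C i" if "i \<in> {1..<n}" "\<beta> i \<le> z" for i
    proof -
      have "C i - C (Suc i) \<ge> 0"
        unfolding diff[OF that(1)] using abs_diff_mono[OF tle[OF that(1)] that(2)] \<alpha>
        by (intro mult_nonneg_nonneg) auto
      then show ?thesis by simp
    qed
    have mz: "m z \<in> {1..n}" "z \<le> \<beta> (m z)" using m z by auto
    \<comment> \<open>From \<open>m z\<close> on every border is at least \<open>z\<close>, before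
      it every border is at most \<open>z\<close>; hence one chain in each direction.\<close>
    have "C (m z) \<le> C k" if "m z \<le> k" "k \<le> n" for k
      using that
    proof (induction k rule: dec_induct)
      case (step k)
      have "\<beta> (m z) \<le> \<beta> k" using step by (intro mono_onD[OF \<beta>(3)]) auto
      with up[of k] step mz show ?case by auto
    qed simp
    moreover have "C (m z) \<le> C k" if "k \<le> m z" "1 \<le> k" for k
      using that
    proof (induction k rule: inc_induct)
      case (step k)
      have "\<beta> k \<le> \<beta> (m z - 1)" using step mz by (intro mono_onD[OF \<beta>(3)]) auto
      with down[of k] step mz m_lower[OF z] show ?case by auto
    qed simp
    moreover obtain k where "k \<in> {1..n}" "j = \<pi> k"
      using j permutes_image[OF perm] by (metis imageE)
    ultimately show ?thesis by (cases "m z \<le> k") (auto simp: C_def g_def)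
  qed
  ultimately have "client_equilibrium n \<alpha> t g" by (auto simp: client_equilibrium_def)
  with perm mono \<beta> gb show ?thesis by (auto simp: proper_client_equilibrium_def)
qed

lemma location_vectors_range: "t \<in> location_vectors n \<Longrightarrow> i \<in> {1..n} \<Longrightarrow> t i \<in> {0..1}"
  by (auto simp: location_vectors_def PiE_iff)

text \<open>The sorting is an input: at ties several permutations qualify, and the deviation lemmas
  choose the identity.\<close>

lemma proper_client_equilibrium_exists:
  assumes \<alpha>: "\<alpha> \<in> {0<..1}" and n: "n \<ge> 1" and t: "t \<in> location_vectors n"
    and perm: "\<pi> permutes {1..n}" and mono: "mono_on {1..n} (t \<circ> \<pi>)"
  shows "\<exists>\<beta> g. balanced_borders n \<alpha> (t \<circ> \<pi>) \<beta> \<and> proper_client_equilibrium n \<alpha> t \<pi> \<beta> g"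
proof -
  have "(t \<circ> \<pi>) i \<in> {0..1}" if "i \<in> {1..n}" for i
    using location_vectors_range[OF t, of "\<pi> i"] permutes_in_image[OF perm] that by simp
  from balanced_borders_exist[OF n \<alpha> mono this]
  obtain \<beta> where "balanced_borders n \<alpha> (t \<circ> \<pi>) \<beta>" by blast
  with balanced_borders_imp_proper[OF \<alpha> n perm mono] show ?thesis by blast
qed

text \<open>A proper equilibrium exists and loads are unique, so the definite description denotes,
  and any client equilibrium can be used to evaluate it.\<close>

lemma induced_utility_eq:
  assumes \<alpha>: "\<alpha> \<in> {0<..1}" and n: "n \<ge> 1" and t: "t \<in> location_vectors n"
    and g: "client_equilibrium n \<alpha> t g" and i: "i \<in> {1..n}"
  shows "induced_utility n \<alpha> t i = load g i"
  unfolding induced_utility_def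
proof (rule the_equality)
  obtain \<pi> where "\<pi> permutes {1..n}" "mono_on {1..n} (t \<circ> \<pi>)"
    using sorting_permutation_exists by blast
  from proper_client_equilibrium_exists[OF \<alpha> n t this]
  obtain \<beta> h where h: "proper_client_equilibrium n \<alpha> t \<pi> \<beta> h" by blast
  then have "load g i = load h i"
    using \<alpha> g i by (intro client_equilibrium_load_unique) (auto simp: proper_client_equilibrium_def)
  with h show "\<exists>\<pi> \<beta> h. proper_client_equilibrium n \<alpha> t \<pi> \<beta> h \<and> load g i = load h i" by blast
next
  fix u assume "\<exists>\<pi> \<beta> h. proper_client_equilibrium n \<alpha> t \<pi> \<beta> h \<and> u = load h i"
  with \<alpha> g i show "u = load g i"
    by (auto simp: proper_client_equilibrium_def intro: client_equilibrium_load_unique)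
qed

section \<open>The optimal locations\<close>

lemma s_opt_eq: "i \<in> {1..n} \<Longrightarrow> s_opt n i = (2 * real i - 1) / (2 * real n)"
  by (simp add: s_opt_def)

lemma s_opt_mono: "mono_on {1..n} (s_opt n)"
  by (rule mono_onI) (auto simp: s_opt_eq intro!: divide_right_mono)

lemma s_opt_in_location_vectors: "s_opt n \<in> location_vectors n"
  by (auto simp: location_vectors_def s_opt_def field_simps)

lemma location_vectors_upd:
  "t \<in> location_vectors n \<Longrightarrow> i \<in> {1..n} \<Longrightarrow> x \<in> {0..1} \<Longrightarrow> t(i := x) \<in> location_vectors n"
  unfolding location_vectors_def by (metis PiE_fun_upd insert_absorb)

text \<open>With borders \<open>k / n\<close> every facility is the midpoint of her interval, so
  both sides of each balance equation vanish.\<close>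

lemma s_opt_load:
  assumes \<alpha>: "\<alpha> \<in> {0<..1}" and n: "n \<ge> 1" and g: "client_equilibrium n \<alpha> (s_opt n) g"
    and i: "i \<in> {1..n}"
  shows "load g i = 1 / real n"
proof -
  define \<beta> where "\<beta> k = real k / real n" for k
  have "balanced_borders n \<alpha> (s_opt n \<circ> id) \<beta>"
    unfolding balanced_borders_def
  proof (intro conjI ballI)
    show "mono_on {0..n} \<beta>"
      by (rule mono_onI) (auto simp: \<beta>_def intro!: divide_right_mono)
    fix k assume k: "k \<in> {1..<n}"
    have "\<bar>s_opt n k - \<beta> k\<bar> = 1 / (2 * real n)" "\<bar>s_opt n (k + 1) - \<beta> k\<bar> = 1 / (2 * real n)"
      using k by (auto simp: s_opt_eq \<beta>_def field_simps)
    moreover have "\<beta> (k + 1) - 2 * \<beta> k + \<beta> (k - 1) = 0"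
      using k by (auto simp: \<beta>_def field_simps of_nat_diff)
    ultimately show "\<alpha> * (\<beta> (k + 1) - 2 * \<beta> k + \<beta> (k - 1)) =
        (1 - \<alpha>) * (\<bar>(s_opt n \<circ> id) k - \<beta> k\<bar> - \<bar>(s_opt n \<circ> id) (k + 1) - \<beta> k\<bar>)" by simp
  qed (use n in \<open>auto simp: \<beta>_def\<close>)
  with balanced_borders_imp_proper[OF \<alpha> n permutes_id, of "s_opt n" \<beta>] s_opt_mono[of n]
  obtain h where h: "proper_client_equilibrium n \<alpha> (s_opt n) id \<beta> h" by (auto simp: comp_def)
  have "load g i = load h i"
    using \<alpha> g h i by (intro client_equilibrium_load_unique) (auto simp: proper_client_equilibrium_def)
  also have "\<dots> = \<beta> i - \<beta> (i - 1)"
    using proper_client_equilibrium_load[OF h i] by simp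
  also have "\<dots> = 1 / real n"
    using i by (auto simp: \<beta>_def field_simps of_nat_diff)
  finally show ?thesis .
qed

section \<open>The continued fraction and the tridiagonal system\<close>

lemma K_tilde_Suc: "K_tilde \<alpha> (Suc m) = - (\<alpha>\<^sup>2 / 4) / (1 + K_tilde \<alpha> m)"
  by (cases m) auto

text \<open>Since \<open>\<alpha>\<^sup>2 / 4 \<le> 1 / 4\<close>, a denominator of at least 1/2
  reproduces the lower bound -1/2. This keeps all denominators of the closed form positive.\<close>

lemma K_tilde_bounds:
  assumes "\<alpha> \<in> {0<..1}"
  shows "- (1 / 2) \<le> K_tilde \<alpha> m \<and> K_tilde \<alpha> m \<le> 0"
proof (induction m)
  case (Suc m)
  have "\<alpha>\<^sup>2 \<le> 1" using assms by (simp add: power_le_one)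
  with Suc show ?case
    unfolding K_tilde_Suc by (auto simp: field_simps)
qed simp

text \<open>
  Elimination from the right end: \<open>b (n - m) = a m * b (n - m - 1) + S m\<close> with
  \<open>a m = - (2 / \<alpha>) * K_tilde \<alpha> m\<close>.  The dummy \<open>K_tilde \<alpha> 0 = 0\<close> makes \<open>m = 0\<close> a valid start.
\<close>

lemma tridiagonal_closed_form:
  fixes b :: "nat \<Rightarrow> real"
  assumes n: "n > 3" and \<alpha>: "\<alpha> \<in> {0<..1}" and bn: "b n = 1"
    and inner: "\<And>i. i \<in> {2..<n} \<Longrightarrow>
      2 * b i = \<alpha> * (b (i - 1) + b (i + 1)) + (1 - \<alpha>) * (2 * real i / real n)"
    and outer: "(1 + \<alpha>) * b 1 = \<alpha> * b 2 + (1 - \<alpha>) * (3 / (2 * real n))"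
  shows "b 1 = 1 / (1 + 2 / (1 + \<alpha>) * K_tilde \<alpha> (n - 2)) *
       ((1 - \<alpha>) / (1 + \<alpha>) * (3 / (2 * real n)) +
        (\<Sum>k = 2..n - 1. (1 - \<alpha>) / (1 + \<alpha>) * (2 * real k / real n) *
           (\<Prod>j = n - k..n - 2. - (2 / \<alpha>) * K_tilde \<alpha> j)) +
        \<alpha> / (1 + \<alpha>) * (\<Prod>j = 1..n - 2. - (2 / \<alpha>) * K_tilde \<alpha> j))"
proof -
  define a where "a m = - (2 / \<alpha>) * K_tilde \<alpha> m" for m
  \<comment> \<open>The \<open>k\<close>-th summand is the source term of equation \<open>k\<close>
    times the factors picked up since its elimination; the last product carries the boundary value
    \<open>b n = 1\<close>. Empty ranges give \<open>S 0 = 1\<close>.\<close>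
  define S where "S m = (\<Sum>k = n - m..n - 1. 2 * (1 - \<alpha>) / \<alpha> * (real k / real n) *
      (\<Prod>j = n - k..m. a j)) + (\<Prod>j = 1..m. a j)" for m
  \<comment> \<open>The continued fraction is the elimination recursion
    \<open>a (Suc m) = \<alpha> / (2 - \<alpha> * a m)\<close>.\<close>
  have a_Suc: "a (Suc m) * (2 - \<alpha> * a m) = \<alpha>" for m
  proof -
    have "1 + K_tilde \<alpha> m > 0" using K_tilde_bounds[OF \<alpha>, of m] by simp
    then show ?thesis
      using \<alpha> unfolding a_def K_tilde_Suc by (simp add: field_simps power2_eq_square)
  qed
  have a_ne: "2 - \<alpha> * a m \<noteq> 0" for m using a_Suc[of m] \<alpha> by auto
  have S_Suc: "S (Suc m) = a (Suc m) * (S m + 2 * (1 - \<alpha>) / \<alpha> * (real (n - Suc m) / real n))"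
    if m: "Suc m < n" for m
  proof -
    have set: "{n - Suc m..n - 1} = insert (n - Suc m) {n - m..n - 1}" using m by auto
    have "(\<Prod>j = n - k..Suc m. a j) = (\<Prod>j = n - k..m. a j) * a (Suc m)"
      if "k \<in> {n - m..n - 1}" for k
    proof -
      have "n - k \<le> Suc m" using that by auto
      then show ?thesis by (simp add: prod.nat_ivl_Suc' mult.commute)
    qed
    then have "(\<Sum>k = n - m..n - 1. 2 * (1 - \<alpha>) / \<alpha> * (real k / real n) * (\<Prod>j = n - k..Suc m. a j))
        = a (Suc m) * (\<Sum>k = n - m..n - 1. 2 * (1 - \<alpha>) / \<alpha> * (real k / real n) * (\<Prod>j = n - k..m. a j))"
      by (auto simp: sum_distrib_left intro!: sum.cong)
    \<comment> \<open>The newly added source term has picked up just the factor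
      \<open>a (Suc m)\<close>.\<close>
    moreover have "n - (n - Suc m) = Suc m" using m by simp
    ultimately show ?thesis
      unfolding S_def set using m by (subst sum.insert) (auto simp: algebra_simps prod.nat_ivl_Suc')
  qed
  have elim: "b (n - m) = a m * b (n - m - 1) + S m" if "m \<le> n - 2" for m
    using that
  proof (induction m)
    case 0
    then show ?case using n bn by (simp add: a_def S_def)
  next
    case (Suc m)
    define i where "i = n - Suc m"
    have i: "i \<in> {2..<n}" "n - m = i + 1" using Suc.prems n by (auto simp: i_def)
    have IH: "b (i + 1) = a m * b i + S m" using Suc i by simp
    \<comment> \<open>Equation \<open>i\<close> after substituting for \<open>b (i + 1)\<close>; the
      rest divides by \<open>2 - \<alpha> * a m\<close>.\<close>
    have "(2 - \<alpha> * a m) * b i = \<alpha> * b (i - 1) + \<alpha> * (S m + 2 * (1 - \<alpha>) / \<alpha> * (real i / real n))"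
    proof -
      have "\<alpha> * (S m + 2 * (1 - \<alpha>) / \<alpha> * (real i / real n)) =
          \<alpha> * S m + (1 - \<alpha>) * (2 * real i / real n)"
        using \<alpha> by (simp add: distrib_left)
      then show ?thesis using inner[OF i(1)] unfolding IH by (simp add: algebra_simps)
    qed
    also have "\<dots> = (a (Suc m) * (2 - \<alpha> * a m)) *
        (b (i - 1) + (S m + 2 * (1 - \<alpha>) / \<alpha> * (real i / real n)))"
      unfolding a_Suc by (simp only: distrib_left)
    also have "\<dots> = (2 - \<alpha> * a m) * (a (Suc m) * b (i - 1) +
        a (Suc m) * (S m + 2 * (1 - \<alpha>) / \<alpha> * (real i / real n)))"
      by (simp only: distrib_left mult_ac)
    also have "a (Suc m) * (S m + 2 * (1 - \<alpha>) / \<alpha> * (real i / real n)) = S (Suc m)"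
      using S_Suc[of m] Suc.prems n by (simp add: i_def)
    finally have "(2 - \<alpha> * a m) * b i = (2 - \<alpha> * a m) * (a (Suc m) * b (i - 1) + S (Suc m))" .
    with a_ne[of m] show ?case by (simp add: i_def)
  qed
  define K where "K = K_tilde \<alpha> (n - 2)"
  \<comment> \<open>Elimination ends at border 2. The equation of border 1 has leading coefficient
    \<open>1 + \<alpha>\<close> instead of 2, because the deviator sits on that border, and is
    treated separately.\<close>
  have "n - (n - 2) = 2" "n - (n - 2) - 1 = 1" using n by auto
  with elim[of "n - 2"] have b2: "b 2 = a (n - 2) * b 1 + S (n - 2)" by simp
  have K: "1 + 2 / (1 + \<alpha>) * K > 0"
    using K_tilde_bounds[OF \<alpha>, of "n - 2"] \<alpha> by (auto simp: K_def field_simps)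
  define r where "r = 3 / (2 * real n)"
  have "(1 + \<alpha>) * b 1 = - 2 * K * b 1 + \<alpha> * S (n - 2) + (1 - \<alpha>) * r"
    using outer \<alpha> unfolding b2 a_def K_def r_def[symmetric] by (simp add: algebra_simps)
  then have "(1 + \<alpha> + 2 * K) * b 1 / (1 + \<alpha>) = ((1 - \<alpha>) * r + \<alpha> * S (n - 2)) / (1 + \<alpha>)"
    by (simp add: algebra_simps)
  moreover have "(1 + \<alpha> + 2 * K) * b 1 / (1 + \<alpha>) = (1 + 2 / (1 + \<alpha>) * K) * b 1"
    using \<alpha> by (simp add: field_simps)
  ultimately have main: "(1 + 2 / (1 + \<alpha>) * K) * b 1 =
      (1 - \<alpha>) / (1 + \<alpha>) * r + \<alpha> / (1 + \<alpha>) * S (n - 2)"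
    by (simp add: add_divide_distrib)
  have coeff: "\<alpha> / (1 + \<alpha>) * (2 * (1 - \<alpha>) / \<alpha> * (real k / real n) * P) =
      (1 - \<alpha>) / (1 + \<alpha>) * (2 * real k / real n) * P" for k P
    using \<alpha> by simp
  have "\<alpha> / (1 + \<alpha>) * S (n - 2) =
      (\<Sum>k = 2..n - 1. (1 - \<alpha>) / (1 + \<alpha>) * (2 * real k / real n) * (\<Prod>j = n - k..n - 2. a j)) +
      \<alpha> / (1 + \<alpha>) * (\<Prod>j = 1..n - 2. a j)"
    by (simp only: S_def distrib_left sum_distrib_left coeff \<open>n - (n - 2) = 2\<close>)
  with main show ?thesis
    using K unfolding K_def a_def r_def by (simp add: nonzero_eq_divide_eq mult.commute)
qed

section \<open>Position of the borders after the deviation\<close>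

text \<open>The offset \<open>e k = b k - k / n\<close> is convex where it is nonnegative and
  concave where it is nonpositive. With \<open>e n = 0\<close> this forces
  \<open>0 \<le> e k \<le> e 1\<close>, and \<open>e 1 \<le> 1 / (2 * n)\<close>, so each inner
  border lies between its two facilities.\<close>

lemma deviation_borders_linear:
  fixes b :: "nat \<Rightarrow> real"
  assumes n: "n > 3" and \<alpha>: "\<alpha> \<in> {0<..1}" and bn: "b n = 1"
    and b1: "b 1 \<le> 3 / (2 * real n)"
    and outer: "\<alpha> * (b 2 - 2 * b 1) = (1 - \<alpha>) * (b 1 - 3 / (2 * real n))"
    and inner: "\<And>i. i \<in> {2..<n} \<Longrightarrow> \<alpha> * (b (i + 1) - 2 * b i + b (i - 1)) =
      (1 - \<alpha>) * (\<bar>(2 * real i - 1) / (2 * real n) - b i\<bar> - \<bar>(2 * real i + 1) / (2 * real n) - b i\<bar>)"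
    and i: "i \<in> {2..<n}"
  shows "2 * b i = \<alpha> * (b (i - 1) + b (i + 1)) + (1 - \<alpha>) * (2 * real i / real n)"
proof -
  define e where "e k = b k - real k / real n" for k
  have n0: "real n > 0" using n by simp
  define q where "q = 1 / (2 * real n)"
  \<comment> \<open>The facilities adjacent to border \<open>k\<close> are at \<open>r - q\<close>
    and \<open>r + q\<close> for \<open>r = k / n\<close>, so the nearer one shows on which side of
    \<open>r\<close> the border lies.\<close>
  have q: "\<bar>r - q - z\<bar> \<le> \<bar>r + q - z\<bar> \<longleftrightarrow> z \<le> r" "\<bar>r + q - z\<bar> \<le> \<bar>r - q - z\<bar> \<longleftrightarrow> r \<le> z" for r z
  proof -
    have "q > 0" using n0 by (simp add: q_def)
    then show "\<bar>r - q - z\<bar> \<le> \<bar>r + q - z\<bar> \<longleftrightarrow> z \<le> r" "\<bar>r + q - z\<bar> \<le> \<bar>r - q - z\<bar> \<longleftrightarrow> r \<le> z"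
      by arith+
  qed
  have centre: "(2 * real k - 1) / (2 * real n) = real k / real n - q"
    "(2 * real k + 1) / (2 * real n) = real k / real n + q" for k
    using n0 by (auto simp: q_def field_simps)
  have e_n: "e n = 0" using bn n by (simp add: e_def)
  have second_diff: "b (Suc k) - 2 * b k + b (k - 1) = e (Suc k) - 2 * e k + e (k - 1)" if "k \<ge> 1" for k
    using that n by (simp add: e_def field_simps of_nat_diff)
  have neg: "e (Suc k) \<le> 2 * e k - e (k - 1)" if "k \<in> {2..<n}" "e k \<le> 0" for k
  proof -
    have "\<bar>(2 * real k - 1) / (2 * real n) - b k\<bar> - \<bar>(2 * real k + 1) / (2 * real n) - b k\<bar> \<le> 0"
      unfolding centre using that(2) by (simp add: e_def q)
    then have "\<alpha> * (b (k + 1) - 2 * b k + b (k - 1)) \<le> 0"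
      unfolding inner[OF that(1)] using \<alpha> by (intro mult_nonneg_nonpos) auto
    with \<alpha> second_diff[of k] that show ?thesis by (simp add: mult_le_0_iff)
  qed
  have pos: "e (Suc k) \<ge> 2 * e k - e (k - 1)" if "k \<in> {2..<n}" "e k \<ge> 0" for k
  proof -
    have "\<bar>(2 * real k - 1) / (2 * real n) - b k\<bar> - \<bar>(2 * real k + 1) / (2 * real n) - b k\<bar> \<ge> 0"
      unfolding centre using that(2) by (simp add: e_def q)
    then have "\<alpha> * (b (k + 1) - 2 * b k + b (k - 1)) \<ge> 0"
      unfolding inner[OF that(1)] using \<alpha> by (intro mult_nonneg_nonneg) auto
    with \<alpha> second_diff[of k] that show ?thesis by (simp add: zero_le_mult_iff)
  qed
  \<comment> \<open>Concavity below 0 passes a negative value reached without rising on up to index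
    \<open>n\<close>, contradicting \<open>e n = 0\<close>; \<open>rise\<close> is the same argument
    with signs reversed.\<close>
  have fall: False if "1 \<le> k" "k < n" "e (Suc k) < 0" "e (Suc k) \<le> e k" for k
  proof -
    have "e l < 0 \<and> e l \<le> e (l - 1)" if "Suc k \<le> l" "l \<le> n" for l
      using that
    proof (induction l rule: dec_induct)
      case base
      then show ?case using \<open>e (Suc k) < 0\<close> \<open>e (Suc k) \<le> e k\<close> by simp
    next
      case (step l)
      with neg[of l] \<open>1 \<le> k\<close> show ?case by auto
    qed
    from this[of n] \<open>k < n\<close> e_n show False by simp
  qed
  have rise: False if "1 \<le> k" "k < n" "e (Suc k) > 0" "e (Suc k) \<ge> e k" for k
  proof -
    have "e l > 0 \<and> e l \<ge> e (l - 1)" if "Suc k \<le> l" "l \<le> n" for l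
      using that
    proof (induction l rule: dec_induct)
      case base
      then show ?case using \<open>e (Suc k) > 0\<close> \<open>e (Suc k) \<ge> e k\<close> by simp
    next
      case (step l)
      with pos[of l] \<open>1 \<le> k\<close> show ?case by auto
    qed
    from this[of n] \<open>k < n\<close> e_n show False by simp
  qed
  \<comment> \<open>The deviator sits at her border, not right of the second facility, so
    \<open>b 2 \<le> 2 * b 1\<close>. If \<open>e 1\<close> were negative, \<open>e 2\<close> would
    be smaller still.\<close>
  have e1: "e 1 \<ge> 0"
  proof (rule ccontr)
    assume "\<not> ?thesis"
    moreover have "\<alpha> * (b 2 - 2 * b 1) \<le> 0"
      unfolding outer using \<alpha> b1 by (intro mult_nonneg_nonpos) auto
    then have "b 2 - 2 * b 1 \<le> 0" using \<alpha> by (simp add: mult_le_0_iff)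
    moreover have "e 2 - 2 * e 1 = b 2 - 2 * b 1" by (simp add: e_def)
    ultimately show False using fall[of 1] n by (simp add: numeral_2_eq_2)
  qed
  have range: "0 \<le> e k \<and> e k \<le> e 1" if "1 \<le> k" "k \<le> n" for k
    using that
  proof (induction k rule: dec_induct)
    case (step k)
    have "e (Suc k) \<ge> 0"
    proof (rule ccontr)
      assume "\<not> ?thesis"
      with fall[of k] step show False by auto
    qed
    moreover have "e (Suc k) \<le> e k"
    proof (rule ccontr)
      assume "\<not> ?thesis"
      with rise[of k] step show False by auto
    qed
    ultimately show ?case using step by auto
  qed (use e1 in auto)
  have "e 1 \<le> 1 / (2 * real n)" using b1 n0 by (simp add: e_def field_simps)
  with range[of i] i have "0 \<le> e i" "e i \<le> 1 / (2 * real n)" by auto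
  then have "(2 * real i - 1) / (2 * real n) \<le> b i" "b i \<le> (2 * real i + 1) / (2 * real n)"
    unfolding centre using n0 by (auto simp: e_def q_def)
  then have "\<bar>(2 * real i - 1) / (2 * real n) - b i\<bar> - \<bar>(2 * real i + 1) / (2 * real n) - b i\<bar> =
      2 * b i - ((2 * real i - 1) / (2 * real n) + (2 * real i + 1) / (2 * real n))" by simp
  also have "(2 * real i - 1) / (2 * real n) + (2 * real i + 1) / (2 * real n) = 2 * real i / real n"
    using n0 by (simp add: field_simps)
  finally have "\<alpha> * (b (i + 1) - 2 * b i + b (i - 1)) = (1 - \<alpha>) * (2 * b i - 2 * real i / real n)"
    using inner[OF i] by simp
  then show ?thesis unfolding right_diff_distrib left_diff_distrib distrib_left by simp
qed

section \<open>Loads of the outmost deviators\<close>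

text \<open>The claimed \<rho> divided by \<open>n\<close>, which turns out to be the deviator's
  load.\<close>

definition deviation_utility :: "nat \<Rightarrow> real \<Rightarrow> real" where
  "deviation_utility n \<alpha> = 1 / (1 + 2 / (1 + \<alpha>) * K_tilde \<alpha> (n - 2)) *
       ((1 - \<alpha>) / (1 + \<alpha>) * (3 / (2 * real n)) +
        (\<Sum>k = 2..n - 1. (1 - \<alpha>) / (1 + \<alpha>) * (2 * real k / real n) *
           (\<Prod>j = n - k..n - 2. - (2 / \<alpha>) * K_tilde \<alpha> j)) +
        \<alpha> / (1 + \<alpha>) * (\<Prod>j = 1..n - 2. - (2 / \<alpha>) * K_tilde \<alpha> j))"

text \<open>Stated for a bare sequence so that it fits facility 1 directly and facility
  \<open>n\<close> after reflection.\<close>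

lemma deviation_border_eq:
  fixes b :: "nat \<Rightarrow> real"
  assumes n: "n > 3" and \<alpha>: "\<alpha> \<in> {0<..1}" and bn: "b n = 1"
    and b1: "b 1 \<le> 3 / (2 * real n)"
    and outer: "\<alpha> * (b 2 - 2 * b 1) = (1 - \<alpha>) * (b 1 - 3 / (2 * real n))"
    and inner: "\<And>i. i \<in> {2..<n} \<Longrightarrow> \<alpha> * (b (i + 1) - 2 * b i + b (i - 1)) =
      (1 - \<alpha>) * (\<bar>(2 * real i - 1) / (2 * real n) - b i\<bar> - \<bar>(2 * real i + 1) / (2 * real n) - b i\<bar>)"
  shows "b 1 = deviation_utility n \<alpha>"
proof -
  have "(1 + \<alpha>) * b 1 = \<alpha> * b 2 + (1 - \<alpha>) * (3 / (2 * real n))"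
    using outer by (simp add: algebra_simps)
  with tridiagonal_closed_form[OF n \<alpha> bn deviation_borders_linear[OF assms]] show ?thesis
    by (simp add: deviation_utility_def)
qed

text \<open>
  The deviator's own border is determined by her load, so the borders may be taken from the
  equilibrium for the identity permutation.
\<close>

lemma first_deviation_load:
  assumes n: "n > 3" and \<alpha>: "\<alpha> \<in> {0<..1}" and x: "x \<in> {0..1}"
    and equil: "proper_client_equilibrium n \<alpha> ((s_opt n)(1 := x)) \<pi> \<beta> g"
    and self: "\<pi> 1 = 1" and x_border: "x = \<beta> 1"
  shows "load g 1 = deviation_utility n \<alpha>"
proof -
  define t where "t = (s_opt n)(1 := x)"
  have t: "t \<in> location_vectors n"
    unfolding t_def using n x by (intro location_vectors_upd s_opt_in_location_vectors) auto
  have perm: "\<pi> permutes {1..n}" and sorted: "mono_on {1..n} (t \<circ> \<pi>)" and "\<beta> 0 = 0"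
    and g: "client_equilibrium n \<alpha> t g"
    using equil by (auto simp: proper_client_equilibrium_def t_def)
  have x_le: "x \<le> t j" if "j \<in> {1..n}" for j
  proof -
    obtain i where "i \<in> {1..n}" "j = \<pi> i"
      using \<open>j \<in> {1..n}\<close> permutes_image[OF perm] by (metis imageE)
    with mono_onD[OF sorted, of 1 i] self show ?thesis by (simp add: t_def)
  qed
  \<comment> \<open>The deviator is leftmost and the others keep their order, so the identity sorts
    too, even if \<pi> breaks ties differently.\<close>
  have "mono_on {1..n} (t \<circ> id)"
  proof (rule mono_onI)
    fix i j assume ij: "i \<in> {1..n}" "j \<in> {1..n}" "i \<le> j"
    show "(t \<circ> id) i \<le> (t \<circ> id) j"
    proof (cases "i = 1")
      case True
      with x_le[OF ij(2)] show ?thesis by (simp add: t_def)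
    next
      case False
      with ij mono_onD[OF s_opt_mono ij] show ?thesis by (simp add: t_def)
    qed
  qed
  from proper_client_equilibrium_exists[OF \<alpha> _ t permutes_id this] n
  obtain b h where bal: "balanced_borders n \<alpha> t b" and h: "proper_client_equilibrium n \<alpha> t id b h"
    by auto
  have b: "b 0 = 0" "b n = 1" using bal by (auto simp: balanced_borders_def)
  have eq: "\<alpha> * (b (i + 1) - 2 * b i + b (i - 1)) = (1 - \<alpha>) * (\<bar>t i - b i\<bar> - \<bar>t (i + 1) - b i\<bar>)"
    if "i \<in> {1..<n}" for i using bal that by (auto simp: balanced_borders_def)
  have hb: "load h 1 = b 1"
    using proper_client_equilibrium_load[OF h, of 1] n b by simp
  have gh: "load g 1 = load h 1"
    using \<alpha> g h n by (intro client_equilibrium_load_unique) (auto simp: proper_client_equilibrium_def)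
  have "load g 1 = \<beta> 1"
    using proper_client_equilibrium_load[OF equil, of 1] n self \<open>\<beta> 0 = 0\<close> by simp
  then have xb: "b 1 = x" using gh hb x_border by simp
  have t2: "t 2 = 3 / (2 * real n)" using n by (simp add: t_def s_opt_eq)
  have "b 1 = deviation_utility n \<alpha>"
  proof (rule deviation_border_eq[where b = b, OF n \<alpha> b(2)])
    show b1: "b 1 \<le> 3 / (2 * real n)" using x_le[of 2] n xb t2 by simp
    \<comment> \<open>The deviator's distance to border 1 is zero, and \<open>b1\<close> opens the
      absolute value for facility 2.\<close>
    show "\<alpha> * (b 2 - 2 * b 1) = (1 - \<alpha>) * (b 1 - 3 / (2 * real n))"
      using eq[of 1] n b xb t2 b1 by (simp add: t_def numeral_2_eq_2)
    fix i assume i: "i \<in> {2..<n}"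
    then have "t i = (2 * real i - 1) / (2 * real n)" "t (i + 1) = (2 * real i + 1) / (2 * real n)"
      by (auto simp: t_def s_opt_eq)
    with eq[of i] i show "\<alpha> * (b (i + 1) - 2 * b i + b (i - 1)) =
      (1 - \<alpha>) * (\<bar>(2 * real i - 1) / (2 * real n) - b i\<bar> - \<bar>(2 * real i + 1) / (2 * real n) - b i\<bar>)"
      by simp
  qed
  with gh hb show ?thesis by simp
qed

text \<open>Reflection of the interval: the borders \<open>c i = 1 - b (n - i)\<close>, measured
  from the right end, satisfy the equations of the left deviation.\<close>

lemma last_deviation_load:
  assumes n: "n > 3" and \<alpha>: "\<alpha> \<in> {0<..1}" and x: "x \<in> {0..1}"
    and equil: "proper_client_equilibrium n \<alpha> ((s_opt n)(n := x)) \<pi> \<beta> g"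
    and self: "\<pi> n = n" and x_border: "x = \<beta> (n - 1)"
  shows "load g n = deviation_utility n \<alpha>"
proof -
  define t where "t = (s_opt n)(n := x)"
  have t: "t \<in> location_vectors n"
    unfolding t_def using n x by (intro location_vectors_upd s_opt_in_location_vectors) auto
  have perm: "\<pi> permutes {1..n}" and sorted: "mono_on {1..n} (t \<circ> \<pi>)" and "\<beta> n = 1"
    and g: "client_equilibrium n \<alpha> t g"
    using equil by (auto simp: proper_client_equilibrium_def t_def)
  have x_ge: "t j \<le> x" if "j \<in> {1..n}" for j
  proof -
    obtain i where "i \<in> {1..n}" "j = \<pi> i"
      using \<open>j \<in> {1..n}\<close> permutes_image[OF perm] by (metis imageE)
    with mono_onD[OF sorted, of i n] self show ?thesis by (simp add: t_def)
  qed
  have "mono_on {1..n} (t \<circ> id)"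
  proof (rule mono_onI)
    fix i j assume ij: "i \<in> {1..n}" "j \<in> {1..n}" "i \<le> j"
    show "(t \<circ> id) i \<le> (t \<circ> id) j"
    proof (cases "j = n")
      case True
      with x_ge[OF ij(1)] show ?thesis by (simp add: t_def)
    next
      case False
      with ij mono_onD[OF s_opt_mono ij] show ?thesis by (simp add: t_def)
    qed
  qed
  from proper_client_equilibrium_exists[OF \<alpha> _ t permutes_id this] n
  obtain b h where bal: "balanced_borders n \<alpha> t b" and h: "proper_client_equilibrium n \<alpha> t id b h"
    by auto
  have b: "b 0 = 0" "b n = 1" using bal by (auto simp: balanced_borders_def)
  have eq: "\<alpha> * (b (i + 1) - 2 * b i + b (i - 1)) = (1 - \<alpha>) * (\<bar>t i - b i\<bar> - \<bar>t (i + 1) - b i\<bar>)"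
    if "i \<in> {1..<n}" for i using bal that by (auto simp: balanced_borders_def)
  have hb: "load h n = 1 - b (n - 1)"
    using proper_client_equilibrium_load[OF h, of n] n b by simp
  have gh: "load g n = load h n"
    using \<alpha> g h n by (intro client_equilibrium_load_unique) (auto simp: proper_client_equilibrium_def)
  have "load g n = 1 - \<beta> (n - 1)"
    using proper_client_equilibrium_load[OF equil, of n] n self \<open>\<beta> n = 1\<close> by simp
  then have xb: "b (n - 1) = x" using gh hb x_border by simp
  have tn1: "t (n - 1) = 1 - 3 / (2 * real n)" using n by (auto simp: t_def s_opt_eq of_nat_diff field_simps)
  define c where "c i = 1 - b (n - i)" for i
  have "c 1 = deviation_utility n \<alpha>"
  proof (rule deviation_border_eq[where b = c, OF n \<alpha>])
    show "c n = 1" using b by (simp add: c_def)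
    have "n - 1 \<in> {1..n}" using n by auto
    with x_ge[of "n - 1"] xb tn1 show c1: "c 1 \<le> 3 / (2 * real n)" by (simp add: c_def)
    have idx: "n - 1 + 1 = n" "n - 1 - 1 = n - 2" "n - 1 \<in> {1..<n}" and tn: "t n = x"
      using n by (auto simp: t_def)
    have "c 2 - 2 * c 1 = - (b n - 2 * b (n - 1) + b (n - 2))" using b by (simp add: c_def)
    moreover have "c 1 - 3 / (2 * real n) = - (\<bar>t (n - 1) - b (n - 1)\<bar> - \<bar>t n - b (n - 1)\<bar>)"
      using c1 tn tn1 xb by (simp add: c_def)
    ultimately show "\<alpha> * (c 2 - 2 * c 1) = (1 - \<alpha>) * (c 1 - 3 / (2 * real n))"
      using eq[OF idx(3)] unfolding idx(1,2) by (simp only: mult_minus_right)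
    fix i assume i: "i \<in> {2..<n}"
    have idx: "n - i + 1 = n - (i - 1)" "n - i - 1 = n - (i + 1)" "n - i \<in> {1..<n}" using i by auto
    \<comment> \<open>Reflection exchanges the two facilities adjacent to a border.\<close>
    have "t (n - i) = 1 - (2 * real i + 1) / (2 * real n)" "t (n - i + 1) = 1 - (2 * real i - 1) / (2 * real n)"
      using i n by (auto simp: t_def s_opt_eq of_nat_diff field_simps)
    then have "\<bar>t (n - i) - b (n - i)\<bar> = \<bar>(2 * real i + 1) / (2 * real n) - c i\<bar>"
      "\<bar>t (n - i + 1) - b (n - i)\<bar> = \<bar>(2 * real i - 1) / (2 * real n) - c i\<bar>"
      unfolding c_def by arith+
    with eq[OF idx(3)]
    show "\<alpha> * (c (i + 1) - 2 * c i + c (i - 1)) =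
      (1 - \<alpha>) * (\<bar>(2 * real i - 1) / (2 * real n) - c i\<bar> - \<bar>(2 * real i + 1) / (2 * real n) - c i\<bar>)"
      unfolding idx(1,2) by (simp add: c_def algebra_simps)
  qed
  with gh hb show ?thesis by (simp add: c_def)
qed

section \<open>Existence of the approximate equilibrium\<close>

theorem theorem4:
  fixes n :: nat and \<alpha> :: real
  assumes "n > 3" and "\<alpha> \<in> {0<..1}"
    and conjecture:
      "(\<exists>x \<pi> \<beta> g. proper_client_equilibrium n \<alpha> ((s_opt n)(1 := x)) \<pi> \<beta> g \<and>
          \<pi> 1 = 1 \<and> x = \<beta> 1 \<and> highest_improvement n \<alpha> (s_opt n) 1 x) \<or>
       (\<exists>x \<pi> \<beta> g. proper_client_equilibrium n \<alpha> ((s_opt n)(n := x)) \<pi> \<beta> g \<and>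
          \<pi> n = n \<and> x = \<beta> (n - 1) \<and> highest_improvement n \<alpha> (s_opt n) n x)"
  shows "\<exists>s f. is_rho_SPE n \<alpha>
     (real n / (1 + 2 / (1 + \<alpha>) * K_tilde \<alpha> (n - 2)) *
       ((1 - \<alpha>) / (1 + \<alpha>) * (3 / (2 * real n)) +
        (\<Sum>k = 2..n - 1. (1 - \<alpha>) / (1 + \<alpha>) * (2 * real k / real n) *
           (\<Prod>j = n - k..n - 2. - (2 / \<alpha>) * K_tilde \<alpha> j)) +
        \<alpha> / (1 + \<alpha>) * (\<Prod>j = 1..n - 2. - (2 / \<alpha>) * K_tilde \<alpha> j))) s f"
proof -
  note n = \<open>n > 3\<close> and \<alpha> = \<open>\<alpha> \<in> {0<..1}\<close>
  have n1: "n \<ge> 1" using n by simp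
  \<comment> \<open>Any choice of client equilibria serves, because the loads do not depend on
    it.\<close>
  define f where "f t = (SOME g. client_equilibrium n \<alpha> t g)" for t
  have f: "client_equilibrium n \<alpha> t (f t)" if t: "t \<in> location_vectors n" for t
  proof -
    obtain \<pi> where "\<pi> permutes {1..n}" "mono_on {1..n} (t \<circ> \<pi>)"
      using sorting_permutation_exists by blast
    from proper_client_equilibrium_exists[OF \<alpha> n1 t this]
    show ?thesis unfolding f_def by (metis proper_client_equilibrium_def someI_ex)
  qed
  note s = s_opt_in_location_vectors[of n]
  have upd: "(s_opt n)(i := x) \<in> location_vectors n" if "i \<in> {1..n}" "x \<in> {0..1}" for i x
    using location_vectors_upd[OF s that] .
  have s_load: "load (f (s_opt n)) i = 1 / real n" if "i \<in> {1..n}" for i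
    using s_opt_load[OF \<alpha> n1 f[OF s] that] .
  have factor: "improvement_factor n \<alpha> (s_opt n) i x = real n * load h i"
    if "i \<in> {1..n}" "x \<in> {0..1}" "client_equilibrium n \<alpha> ((s_opt n)(i := x)) h" for i x h
    unfolding improvement_factor_def
    using induced_utility_eq[OF \<alpha> n1 upd[OF that(1,2)] that(3,1)]
      induced_utility_eq[OF \<alpha> n1 s f[OF s] that(1)] s_load[OF that(1)] by simp
  have "\<exists>i x. highest_improvement n \<alpha> (s_opt n) i x \<and>
      improvement_factor n \<alpha> (s_opt n) i x = real n * deviation_utility n \<alpha>"
    using conjecture
  proof (elim disjE exE conjE)
    fix x \<pi> \<beta> g
    assume *: "proper_client_equilibrium n \<alpha> ((s_opt n)(1 := x)) \<pi> \<beta> g" "\<pi> 1 = 1" "x = \<beta> 1"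
      and high: "highest_improvement n \<alpha> (s_opt n) 1 x"
    then have x: "1 \<in> {1..n}" "x \<in> {0..1}" by (auto simp: highest_improvement_def)
    have "improvement_factor n \<alpha> (s_opt n) 1 x = real n * load g 1"
      using * by (intro factor[OF x]) (simp add: proper_client_equilibrium_def)
    with high first_deviation_load[OF n \<alpha> x(2) *] show ?thesis by metis
  next
    fix x \<pi> \<beta> g
    assume *: "proper_client_equilibrium n \<alpha> ((s_opt n)(n := x)) \<pi> \<beta> g" "\<pi> n = n" "x = \<beta> (n - 1)"
      and high: "highest_improvement n \<alpha> (s_opt n) n x"
    then have x: "n \<in> {1..n}" "x \<in> {0..1}" by (auto simp: highest_improvement_def)
    have "improvement_factor n \<alpha> (s_opt n) n x = real n * load g n"
      using * by (intro factor[OF x]) (simp add: proper_client_equilibrium_def)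
    with high last_deviation_load[OF n \<alpha> x(2) *] show ?thesis by metis
  qed
  then have best: "improvement_factor n \<alpha> (s_opt n) j y \<le> real n * deviation_utility n \<alpha>"
    if "j \<in> {1..n}" "y \<in> {0..1}" for j y
    using that by (auto simp: highest_improvement_def)
  have "is_rho_SPE n \<alpha> (real n * deviation_utility n \<alpha>) (s_opt n) f"
    unfolding is_rho_SPE_def
  proof (intro conjI ballI s f)
    fix i and x :: real assume ix: "i \<in> {1..n}" "x \<in> {0..1}"
    \<comment> \<open>At the optimum \<rho> times the load \<open>1 / n\<close> is
      \<open>deviation_utility\<close>, so the bound \<open>best\<close> on improvement factors
      becomes the SPE inequality after cancelling \<open>n\<close>.\<close>
    have "real n * load (f ((s_opt n)(i := x))) i \<le> real n * deviation_utility n \<alpha>"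
      using best[OF ix] factor[OF ix f[OF upd[OF ix]]] by simp
    with n show "load (f ((s_opt n)(i := x))) i \<le>
        real n * deviation_utility n \<alpha> * load (f (s_opt n)) i"
      unfolding s_load[OF ix(1)] by simp
  qed
  then show ?thesis unfolding deviation_utility_def mult.assoc[symmetric] by auto
qed

end
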